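(* Let $(W,S)$ be a purely infinite Coxeter system ($S$ not assumed finite), with length function $l$ with respect to $S$. If $w\in W$ and $w\neq 1$, then there exists $s\in S$ such that: (a) $w^{-1}sw\notin S$; and (b) $l(sw)>l(w)$.
   Context: A Coxeter system $(W,S)$ is purely infinite if each of its irreducible factors is infinite; the irreducible factors are the Coxeter systems $(\langle S_i\rangle,S_i)$, where the $S_i$ are the vertex sets of the connected components of the Coxeter diagram of $(W,S)$. *)

theory Defs
  imports "HOL-Algebra.Generated_Groups" "HOL-Library.Extended_Nat"
begin

section \<open>Group presentations\<close>

text \<open>Words in a set of generators and their formal inverses: the letter \<open>(True, s)\<close> stands for
  \<open>s\<close>, and \<open>(False, s)\<close> for its formal inverse.\<close>

type_synonym 'a gen_word = "(bool \<times> 'a) list"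

definition gen_words :: "'a set \<Rightarrow> 'a gen_word set" where
  "gen_words S = lists (UNIV \<times> S)"

definition eval_word :: "('a, 'b) monoid_scheme \<Rightarrow> 'a gen_word \<Rightarrow> 'a" where
  "eval_word G u =
     foldr (\<lambda>(b, s) g. (if b then s else inv\<^bsub>G\<^esub> s) \<otimes>\<^bsub>G\<^esub> g) u \<one>\<^bsub>G\<^esub>"

text \<open>Equality of words in the abstract group with generators \<open>S\<close> and relators \<open>R\<close>, i.e.\ in the
  quotient of the free group on \<open>S\<close> by the normal closure of \<open>R\<close>.\<close>

inductive pres_eq :: "'a set \<Rightarrow> 'a gen_word set \<Rightarrow> 'a gen_word \<Rightarrow> 'a gen_word \<Rightarrow> bool"
  for S :: "'a set" and R :: "'a gen_word set" where
  refl: "u \<in> gen_words S \<Longrightarrow> pres_eq S R u u"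
| sym: "pres_eq S R u v \<Longrightarrow> pres_eq S R v u"
| trans: "pres_eq S R u v \<Longrightarrow> pres_eq S R v x \<Longrightarrow> pres_eq S R u x"
| cancel: "u \<in> gen_words S \<Longrightarrow> v \<in> gen_words S \<Longrightarrow> s \<in> S \<Longrightarrow>
    pres_eq S R (u @ [(b, s), (\<not> b, s)] @ v) (u @ v)"
| relator: "u \<in> gen_words S \<Longrightarrow> v \<in> gen_words S \<Longrightarrow> r \<in> R \<Longrightarrow>
    pres_eq S R (u @ r @ v) (u @ v)"

text \<open>\<open>G\<close> has the presentation \<open>\<langle>S | R\<rangle>\<close>: evaluation of words induces an isomorphism from the
  abstractly presented group onto \<open>G\<close>.\<close>

definition has_presentation ::
    "('a, 'b) monoid_scheme \<Rightarrow> 'a set \<Rightarrow> 'a gen_word set \<Rightarrow> bool" where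
  "has_presentation G S R \<longleftrightarrow>
     group G \<and> S \<subseteq> carrier G \<and> R \<subseteq> gen_words S \<and> generate G S = carrier G \<and>
     (\<forall>u \<in> gen_words S. \<forall>v \<in> gen_words S.
        eval_word G u = eval_word G v \<longleftrightarrow> pres_eq S R u v)"

section \<open>Coxeter systems\<close>

definition coxeter_matrix :: "'a set \<Rightarrow> ('a \<Rightarrow> 'a \<Rightarrow> enat) \<Rightarrow> bool" where
  "coxeter_matrix S m \<longleftrightarrow>
     (\<forall>s \<in> S. \<forall>t \<in> S. m s t = m t s \<and> 1 \<le> m s t \<and> (m s t = 1 \<longleftrightarrow> s = t))"

text \<open>The relators \<open>(st)\<^sup>m\<close> with \<open>m = m(s,t)\<close> finite; the case \<open>s = t\<close> is the relator \<open>ss\<close>.\<close>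

definition coxeter_relators :: "'a set \<Rightarrow> ('a \<Rightarrow> 'a \<Rightarrow> enat) \<Rightarrow> 'a gen_word set" where
  "coxeter_relators S m =
     {concat (replicate n [(True, s), (True, t)]) | s t n. s \<in> S \<and> t \<in> S \<and> m s t = enat n}"

text \<open>\<open>(G, S)\<close> is a Coxeter system, with Coxeter matrix \<open>m\<close>. The set \<open>S\<close> may be infinite.\<close>

definition coxeter_system ::
    "('a, 'b) monoid_scheme \<Rightarrow> 'a set \<Rightarrow> ('a \<Rightarrow> 'a \<Rightarrow> enat) \<Rightarrow> bool" where
  "coxeter_system G S m \<longleftrightarrow>
     coxeter_matrix S m \<and> has_presentation G S (coxeter_relators S m)"

definition coxeter_edges :: "'a set \<Rightarrow> ('a \<Rightarrow> 'a \<Rightarrow> enat) \<Rightarrow> ('a \<times> 'a) set" where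
  "coxeter_edges S m = {(s, t). s \<in> S \<and> t \<in> S \<and> 3 \<le> m s t}"

text \<open>The vertex sets of the connected components of the Coxeter diagram.\<close>

definition coxeter_components :: "'a set \<Rightarrow> ('a \<Rightarrow> 'a \<Rightarrow> enat) \<Rightarrow> 'a set set" where
  "coxeter_components S m = S // {(s, t). s \<in> S \<and> t \<in> S \<and> (s, t) \<in> (coxeter_edges S m)\<^sup>*}"

definition purely_infinite ::
    "('a, 'b) monoid_scheme \<Rightarrow> 'a set \<Rightarrow> ('a \<Rightarrow> 'a \<Rightarrow> enat) \<Rightarrow> bool" where
  "purely_infinite G S m \<longleftrightarrow> (\<forall>C \<in> coxeter_components S m. infinite (generate G C))"

text \<open>The length of \<open>g\<close> is the least \<open>n\<close> such that \<open>g = s\<^sub>1 \<dots> s\<^sub>n\<close> with all \<open>s\<^sub>i \<in> S\<close>. No inverses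
  are needed, since the generators in a Coxeter system are involutions.\<close>

definition coxeter_length :: "('a, 'b) monoid_scheme \<Rightarrow> 'a set \<Rightarrow> 'a \<Rightarrow> nat" where
  "coxeter_length G S g =
     (LEAST n. \<exists>ss \<in> lists S. length ss = n \<and> foldr (\<otimes>\<^bsub>G\<^esub>) ss \<one>\<^bsub>G\<^esub> = g)"

end

theory Submission
  imports Defs Complex_Main "HOL-Library.Sublist"
begin

text \<open>Suppose every \<open>s \<in> S\<close> with \<open>l(sw) > l(w)\<close> satisfies \<open>w\<^sup>-\<^sup>1sw \<in> S\<close>, and let \<open>A\<close> be the set of these
  \<open>s\<close>. If \<open>a \<in> W\<^sub>A\<close>, then \<open>aw = wb\<close> with \<open>l(b) \<le> l(a)\<close>, so all generators outside \<open>A\<close> remain left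
  descents of \<open>aw\<close>. The exchange condition then shows that every \<open>g \<in> W\<close> is an initial part of some
  reduced product \<open>aw\<close> with \<open>a \<in> W\<^sub>A\<close>. Hence \<open>g\<close> is a product of an element of \<open>W\<^sub>A\<close> and a subword of
  a fixed reduced word of \<open>w\<close>, and \<open>W\<^sub>A\<close> has finite index.

  As \<open>w \<noteq> 1\<close>, there is \<open>d \<in> S - A\<close>. Its component generates an infinite group, so this group contains
  some \<open>k \<noteq> 1\<close> all of whose conjugates lie in \<open>W\<^sub>A\<close>. Let \<open>I \<subseteq> A\<close> be the set of letters in reduced
  words of these conjugates. If \<open>s \<in> S - I\<close>, then \<open>x\<close> and \<open>sxs\<close> both lie in \<open>W\<^sub>I\<close> for each conjugate \<open>x\<close>,
  which forces \<open>s\<close> to commute with the letters of \<open>x\<close>. Thus \<open>I\<close> is closed under adjacency in the diagram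
  and contains \<open>d\<close>, a contradiction.\<close>

section \<open>A trigonometric sum and the core of a subgroup of finite index\<close>

text \<open>Multiplied by \<open>2 * sin (pi / n)\<close>, each term becomes a difference of
  consecutive cosines; the sum telescopes, and its two end angles differ by a full period.\<close>

lemma sum_sin_roots:
  assumes "n \<ge> 2"
  shows "(\<Sum>i<n. sin (2 * real i * (pi / n) + c)) = 0"
proof -
  let ?u = "\<lambda>i. cos ((2 * real i - 1) * (pi / n) + c)"
  have "0 < pi / n" "pi / n < pi" using assms by (simp_all add: field_simps)
  then have nz: "sin (pi / n) \<noteq> 0" using sin_gt_zero by fastforce
  have "2 * sin (pi / n) * sin (2 * real i * (pi / n) + c) = ?u i - ?u (Suc i)" for i
  proof -
    have "?u i = cos (2 * real i * (pi / n) + c - pi / n)"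
      "?u (Suc i) = cos (2 * real i * (pi / n) + c + pi / n)"
      by (simp_all add: algebra_simps add_divide_distrib diff_divide_distrib)
    then show ?thesis by (simp add: cos_diff cos_add)
  qed
  then have "2 * sin (pi / n) * (\<Sum>i<n. sin (2 * real i * (pi / n) + c)) = (\<Sum>i<n. ?u i - ?u (Suc i))"
    by (simp add: sum_distrib_left)
  also have "\<dots> = ?u 0 - ?u n"
    by (rule sum_lessThan_telescope')
  also have "(2 * real n - 1) * (pi / n) + c = (- 1) * (pi / n) + c + 2 * pi"
    using assms by (simp add: field_simps)
  also have "?u 0 - cos \<dots> = 0"
    unfolding cos_periodic by simp
  finally show ?thesis using nz by simp
qed

text \<open>The witnesses are two elements of \<open>X\<close> that permute the finitely many cosets \<open>H f\<close> in the same way.\<close>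

lemma (in group) finite_index_core:
  assumes H: "subgroup H G" and F: "finite F" "F \<subseteq> carrier G"
    and cover: "\<And>g. g \<in> carrier G \<Longrightarrow> \<exists>a \<in> H. \<exists>f \<in> F. g = a \<otimes> f"
    and X: "infinite X" "X \<subseteq> carrier G"
  shows "\<exists>x \<in> X. \<exists>y \<in> X. x \<noteq> y \<and>
    (\<forall>g \<in> carrier G. g \<otimes> (x \<otimes> inv y) \<otimes> inv g \<in> H)"
proof -
  have "\<exists>f' \<in> F. \<exists>a \<in> H. f \<otimes> x = a \<otimes> f'" if "f \<in> F" "x \<in> X" for f x
    using cover[of "f \<otimes> x"] that F X by blast
  then obtain p where p: "\<And>f x. f \<in> F \<Longrightarrow> x \<in> X \<Longrightarrow> p f x \<in> F"
    "\<And>f x. f \<in> F \<Longrightarrow> x \<in> X \<Longrightarrow> \<exists>a \<in> H. f \<otimes> x = a \<otimes> p f x"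
    by metis
  let ?\<phi> = "\<lambda>x. \<lambda>f\<in>F. p f x"
  have "?\<phi> ` X \<subseteq> F \<rightarrow>\<^sub>E F" using p(1) by auto
  then have "finite (?\<phi> ` X)" using F(1) by (meson finite_PiE finite_subset)
  with X(1) have "\<not> inj_on ?\<phi> X" using finite_imageD by blast
  then obtain x y where xy: "x \<in> X" "y \<in> X" "x \<noteq> y" "?\<phi> x = ?\<phi> y"
    unfolding inj_on_def by blast
  have cl: "x \<in> carrier G" "y \<in> carrier G" using xy X by auto
  have "g \<otimes> (x \<otimes> inv y) \<otimes> inv g \<in> H" if g: "g \<in> carrier G" for g
  proof -
    obtain a f where a: "a \<in> H" "f \<in> F" "g = a \<otimes> f" using cover g by blast
    obtain b where b: "b \<in> H" "f \<otimes> x = b \<otimes> p f x" using p(2) a xy by blast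
    obtain c where c: "c \<in> H" "f \<otimes> y = c \<otimes> p f y" using p(2) a xy by blast
    have eq: "p f x = p f y" using xy(4) a(2) by (metis restrict_apply')
    have mem: "a \<in> carrier G" "b \<in> carrier G" "c \<in> carrier G" "f \<in> carrier G" "p f y \<in> carrier G"
      using a b c p(1)[OF a(2) xy(2)] F subgroup.mem_carrier[OF H] by auto
    \<comment> \<open>\<open>f \<otimes> x\<close> and \<open>f \<otimes> y\<close> lie in the same
      coset of \<open>H\<close>, so their quotient lies in \<open>H\<close>, and conjugation by
      \<open>a\<close> stays there.\<close>
    have "g \<otimes> (x \<otimes> inv y) \<otimes> inv g = a \<otimes> ((f \<otimes> x) \<otimes> inv (f \<otimes> y)) \<otimes> inv a"
      using mem cl by (simp add: a(3) inv_mult_group m_assoc)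
    also have "(f \<otimes> x) \<otimes> inv (f \<otimes> y) = b \<otimes> inv c"
      unfolding b(2) c(2) eq using mem by (simp add: inv_mult_group m_assoc) (simp flip: m_assoc)
    finally show ?thesis
      using a b c subgroup.m_closed[OF H] subgroup.m_inv_closed[OF H] by simp
  qed
  with xy show ?thesis by blast
qed

section \<open>Words in the generators and actions of the presented group\<close>

locale coxeter = group G for G :: "('a, 'b) monoid_scheme" (structure) +
  fixes S :: "'a set" and m :: "'a \<Rightarrow> 'a \<Rightarrow> enat"
  assumes coxeter_system: "coxeter_system G S m"
begin

definition ev :: "'a list \<Rightarrow> 'a" where
  "ev ss = foldr (\<otimes>) ss \<one>"

abbreviation len :: "'a \<Rightarrow> nat" where
  "len \<equiv> coxeter_length G S"

lemma S_carrier: "S \<subseteq> carrier G"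
  and generate_S: "generate G S = carrier G"
  and relators_gen_words: "coxeter_relators S m \<subseteq> gen_words S"
  and eval_word_eq_iff: "u \<in> gen_words S \<Longrightarrow> v \<in> gen_words S \<Longrightarrow>
    eval_word G u = eval_word G v \<longleftrightarrow> pres_eq S (coxeter_relators S m) u v"
  using coxeter_system unfolding coxeter_system_def has_presentation_def by blast+

lemma m_sym: "s \<in> S \<Longrightarrow> t \<in> S \<Longrightarrow> m s t = m t s"
  and m_ge_1: "s \<in> S \<Longrightarrow> t \<in> S \<Longrightarrow> 1 \<le> m s t"
  and m_eq_1_iff: "s \<in> S \<Longrightarrow> t \<in> S \<Longrightarrow> m s t = 1 \<longleftrightarrow> s = t"
  using coxeter_system unfolding coxeter_system_def coxeter_matrix_def by blast+

lemma S_closed [simp]: "s \<in> S \<Longrightarrow> s \<in> carrier G"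
  using S_carrier by blast

lemma ev_Nil [simp]: "ev [] = \<one>"
  and ev_Cons [simp]: "ev (s # ss) = s \<otimes> ev ss"
  by (simp_all add: ev_def)

lemma ev_closed [simp]: "set ss \<subseteq> S \<Longrightarrow> ev ss \<in> carrier G"
  by (induction ss) auto

lemma ev_append [simp]: "set us \<subseteq> S \<Longrightarrow> set vs \<subseteq> S \<Longrightarrow> ev (us @ vs) = ev us \<otimes> ev vs"
  by (induction us) (auto simp: m_assoc)

lemma eval_word_positive: "eval_word G (map (Pair True) ss) = ev ss"
  by (induction ss) (auto simp: eval_word_def)

lemma positive_gen_word: "set ss \<subseteq> S \<Longrightarrow> map (Pair True) ss \<in> gen_words S"
  by (auto simp: gen_words_def)

lemma relator_positive:
  "concat (replicate n [(True, s), (True, t)]) = map (Pair True) (concat (replicate n [s, t]))"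
  by (induction n) auto

lemma ev_replicate:
  "s \<in> S \<Longrightarrow> t \<in> S \<Longrightarrow> ev (concat (replicate n [s, t])) = (s \<otimes> t) [^] n"
proof (induction n)
  case (Suc n)
  then have "ev (concat (replicate (Suc n) [s, t])) = (s \<otimes> t) \<otimes> (s \<otimes> t) [^] n"
    by (simp add: m_assoc)
  with Suc.prems show ?case
    by (metis S_closed m_closed nat_pow_Suc2)
qed simp

lemma relation:
  assumes "s \<in> S" "t \<in> S" "m s t = enat n"
  shows "(s \<otimes> t) [^] n = \<one>"
proof -
  let ?r = "concat (replicate n [(True, s), (True, t)])"
  have r: "?r \<in> coxeter_relators S m"
    using assms unfolding coxeter_relators_def by blast
  have nil: "[] \<in> gen_words S" by (simp add: gen_words_def)
  have "pres_eq S (coxeter_relators S m) ([] @ ?r @ []) ([] @ [])"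
    by (rule pres_eq.relator[OF nil nil r])
  then have "eval_word G ?r = eval_word G []"
    using eval_word_eq_iff r relators_gen_words nil by auto
  then show ?thesis
    using assms by (simp add: relator_positive eval_word_positive ev_replicate)
      (simp add: eval_word_def)
qed

lemma S_square [simp]: "s \<in> S \<Longrightarrow> s \<otimes> s = \<one>"
  using relation[of s s 1] m_eq_1_iff[of s s] by (simp add: one_enat_def)

lemma S_inv [simp]: "s \<in> S \<Longrightarrow> inv s = s"
  by (simp add: inv_equality)

lemma S_cancel [simp]: "s \<in> S \<Longrightarrow> x \<in> carrier G \<Longrightarrow> s \<otimes> (s \<otimes> x) = x"
  by (simp flip: m_assoc)

lemma S_cancel_right [simp]: "s \<in> S \<Longrightarrow> x \<in> carrier G \<Longrightarrow> x \<otimes> s \<otimes> s = x"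
  by (simp add: m_assoc)

lemma ev_rev: "set ss \<subseteq> S \<Longrightarrow> ev (rev ss) = inv (ev ss)"
  by (induction ss) (auto simp: inv_mult_group)

lemma ev_in_generate: "set ss \<subseteq> J \<Longrightarrow> ev ss \<in> generate G J"
  by (induction ss) (auto intro: generate.intros)

lemma generate_word:
  assumes "g \<in> generate G J" "J \<subseteq> S"
  obtains ss where "set ss \<subseteq> J" "ev ss = g"
proof -
  have "\<exists>ss. set ss \<subseteq> J \<and> ev ss = g"
    using assms(1)
  proof induction
    case one
    show ?case by (rule exI[of _ "[]"]) simp
  next
    case (incl h)
    with assms(2) show ?case by (intro exI[of _ "[h]"]) auto
  next
    case (inv h)
    with assms(2) show ?case by (intro exI[of _ "[h]"]) auto
  next
    case (eng h1 h2)
    then obtain us vs where "set us \<subseteq> J" "ev us = h1" "set vs \<subseteq> J" "ev vs = h2" by blast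
    with assms(2) show ?case by (intro exI[of _ "us @ vs"]) auto
  qed
  with that show ?thesis by blast
qed

lemma generate_subgroup: "J \<subseteq> S \<Longrightarrow> subgroup (generate G J) G"
  using S_carrier by (intro generate_is_subgroup) auto

lemma generate_closed: "J \<subseteq> S \<Longrightarrow> x \<in> generate G J \<Longrightarrow> x \<in> carrier G"
  by (rule subgroup.mem_carrier[OF generate_subgroup])

lemma generate_mult:
  "J \<subseteq> S \<Longrightarrow> x \<in> generate G J \<Longrightarrow> y \<in> generate G J \<Longrightarrow> x \<otimes> y \<in> generate G J"
  by (rule generate.eng)

lemma generate_inv: "J \<subseteq> S \<Longrightarrow> x \<in> generate G J \<Longrightarrow> inv x \<in> generate G J"
  by (rule subgroup.m_inv_closed[OF generate_subgroup])

text \<open>The universal property of the presentation, for actions by transformations.\<close>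

lemma foldr_action_eq:
  fixes \<phi> :: "'a \<Rightarrow> 'x \<Rightarrow> 'x"
  assumes invol: "\<And>s x. s \<in> S \<Longrightarrow> \<phi> s (\<phi> s x) = x"
    and rel: "\<And>s t n x. s \<in> S \<Longrightarrow> t \<in> S \<Longrightarrow> m s t = enat n \<Longrightarrow> ((\<phi> s \<circ> \<phi> t) ^^ n) x = x"
    and "set ss \<subseteq> S" "set ts \<subseteq> S" "ev ss = ev ts"
  shows "foldr \<phi> ss x = foldr \<phi> ts x"
proof -
  \<comment> \<open>The signs of letters can be ignored: each \<open>\<phi> s\<close> is an
    involution, so the cancellation rule of \<open>pres_eq\<close> is respected as well.\<close>
  have "foldr (\<phi> \<circ> snd) u x = foldr (\<phi> \<circ> snd) v x"
    if "pres_eq S (coxeter_relators S m) u v" for u v x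
    using that
  proof (induction arbitrary: x)
    case (relator u v r)
    then obtain s t n where r: "r = concat (replicate n [(True, s), (True, t)])"
      and st: "s \<in> S" "t \<in> S" "m s t = enat n"
      unfolding coxeter_relators_def by blast
    have "foldr (\<phi> \<circ> snd) (concat (replicate n [(True, s), (True, t)])) y = ((\<phi> s \<circ> \<phi> t) ^^ n) y"
      for y n by (induction n) auto
    with rel[OF st] show ?case unfolding r foldr_append by simp
  qed (auto simp: invol)
  moreover have "pres_eq S (coxeter_relators S m) (map (Pair True) ss) (map (Pair True) ts)"
    using eval_word_eq_iff[OF positive_gen_word positive_gen_word, of ss ts] assms(3-5)
    by (simp add: eval_word_positive)
  ultimately have "foldr (\<phi> \<circ> snd) (map (Pair True) ss) x = foldr (\<phi> \<circ> snd) (map (Pair True) ts) x" .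
  then show ?thesis by (simp add: foldr_map o_def)
qed

subsection \<open>Length and the exchange condition\<close>

lemma len_ev_le: "set ss \<subseteq> S \<Longrightarrow> len (ev ss) \<le> length ss"
  unfolding coxeter_length_def ev_def by (intro Least_le) (auto simp: in_lists_conv_set)

lemma reduced_word:
  assumes "g \<in> carrier G"
  obtains ss where "set ss \<subseteq> S" "ev ss = g" "length ss = len g"
proof -
  obtain ts where "set ts \<subseteq> S" "ev ts = g"
    using assms generate_S generate_word by (metis order_refl)
  then have "\<exists>n. \<exists>ss\<in>lists S. length ss = n \<and> foldr (\<otimes>) ss \<one> = g"
    unfolding ev_def by (intro exI[of _ "length ts"] bexI[of _ ts]) auto
  from LeastI_ex[OF this] that show ?thesis
    unfolding coxeter_length_def ev_def by (auto simp: in_lists_conv_set subset_code(1))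
qed

lemma len_mult_le:
  assumes "x \<in> carrier G" "y \<in> carrier G"
  shows "len (x \<otimes> y) \<le> len x + len y"
proof -
  obtain us vs where "set us \<subseteq> S" "ev us = x" "length us = len x"
    "set vs \<subseteq> S" "ev vs = y" "length vs = len y"
    using assms reduced_word by metis
  then show ?thesis using len_ev_le[of "us @ vs"] by simp
qed

lemma len_inv [simp]:
  assumes "x \<in> carrier G"
  shows "len (inv x) = len x"
proof -
  have le: "len (inv y) \<le> len y" if y: "y \<in> carrier G" for y
  proof -
    obtain us where "set us \<subseteq> S" "ev us = y" "length us = len y"
      by (rule reduced_word[OF y])
    then show ?thesis using len_ev_le[of "rev us"] by (simp add: ev_rev)
  qed
  from le[of x] le[of "inv x"] assms show ?thesis by simp
qed

lemma len_S_le: "s \<in> S \<Longrightarrow> len s \<le> 1"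
  using len_ev_le[of "[s]"] by simp

lemma len_one [simp]: "len \<one> = 0"
  using len_ev_le[of "[]"] by simp

text \<open>The action of \<open>W\<close> on signed reflections; letting \<open>g\<close> range over the whole group is harmless.\<close>

fun flip :: "'a \<Rightarrow> 'a \<times> bool \<Rightarrow> 'a \<times> bool" where
  "flip s (g, e) = (if g \<in> carrier G then (s \<otimes> g \<otimes> s, e \<noteq> (g = s)) else (g, e))"

lemma flip_flip:
  assumes "s \<in> S"
  shows "flip s (flip s p) = p"
proof (cases p)
  case (Pair g e)
  have "s \<otimes> g \<otimes> s = s \<longleftrightarrow> g = s" if "g \<in> carrier G"
    using assms that by (metis S_cancel S_cancel_right S_closed S_square l_one m_closed)
  with Pair assms show ?thesis by (auto simp: m_assoc)
qed

lemma conj_eq_iff: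
  assumes "a \<in> carrier G" "g \<in> carrier G" "c \<in> carrier G"
  shows "inv a \<otimes> g \<otimes> a = c \<longleftrightarrow> g = a \<otimes> c \<otimes> inv a"
proof
  assume "inv a \<otimes> g \<otimes> a = c"
  then have "a \<otimes> c \<otimes> inv a = a \<otimes> (inv a \<otimes> g \<otimes> a) \<otimes> inv a" by simp
  also have "\<dots> = g" using assms by (simp add: m_assoc) (simp flip: m_assoc)
  finally show "g = a \<otimes> c \<otimes> inv a" by simp
next
  assume "g = a \<otimes> c \<otimes> inv a"
  then show "inv a \<otimes> g \<otimes> a = c" using assms by (simp add: m_assoc) (simp flip: m_assoc)
qed

text \<open>Read from the right, the letters of \<open>s t ... s t\<close> test for the successive
  reflections \<open>t\<close>, \<open>t s t\<close>, \<open>t s t s t\<close> and so on; the sum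
  counts how many of the first \<open>2 * k\<close> equal \<open>g\<close>.\<close>

lemma flip_pow:
  assumes "s \<in> S" "t \<in> S" "g \<in> carrier G"
  shows "((flip s \<circ> flip t) ^^ k) (g, e) =
    ((s \<otimes> t) [^] k \<otimes> g \<otimes> (t \<otimes> s) [^] k,
     e \<noteq> odd (\<Sum>j<2 * k. of_bool (g = (t \<otimes> s) [^] j \<otimes> t) :: nat))"
proof (induction k)
  case 0
  with assms show ?case by simp
next
  case (Suc k)
  define x where "x = s \<otimes> t"
  define y where "y = t \<otimes> s"
  have c [simp]: "x \<in> carrier G" "y \<in> carrier G" "s \<in> carrier G" "t \<in> carrier G"
    using assms by (auto simp: x_def y_def)
  have "x \<otimes> y = \<one>"
    using assms by (simp add: x_def y_def m_assoc)
  then have y_eq: "y = inv x"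
    by (metis c(1,2) inv_equality inv_inv)
  have xy: "x [^] k = inv (y [^] k)"
    by (simp add: y_eq nat_pow_inv)
  have tx: "t \<otimes> x [^] i = y [^] i \<otimes> t" for i :: nat
  proof (induction i)
    case (Suc i)
    have "t \<otimes> x [^] Suc i = y [^] i \<otimes> t \<otimes> x"
      using Suc by (simp flip: m_assoc)
    also have "\<dots> = y [^] Suc i \<otimes> t"
      by (simp add: x_def y_def m_assoc assms)
    finally show ?case .
  qed simp
  \<comment> \<open>The next round flips at \<open>t\<close> and then at \<open>s\<close>; pulled
    back to \<open>g\<close>, the two tests are those with indices \<open>2 * k\<close> and
    \<open>2 * k + 1\<close>.\<close>
  have eq1: "x [^] k \<otimes> g \<otimes> y [^] k = t \<longleftrightarrow> g = y [^] (2 * k) \<otimes> t"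
  proof -
    have "x [^] k \<otimes> g \<otimes> y [^] k = t \<longleftrightarrow> g = y [^] k \<otimes> t \<otimes> x [^] k"
      using assms unfolding xy by (simp add: conj_eq_iff)
    also have "y [^] k \<otimes> t \<otimes> x [^] k = y [^] (2 * k) \<otimes> t"
      by (simp add: m_assoc tx mult_2 flip: nat_pow_mult)
    finally show ?thesis .
  qed
  have eq2: "t \<otimes> (x [^] k \<otimes> g \<otimes> y [^] k) \<otimes> t = s \<longleftrightarrow> g = y [^] Suc (2 * k) \<otimes> t"
  proof -
    have "t \<otimes> (x [^] k \<otimes> g \<otimes> y [^] k) \<otimes> t = s \<longleftrightarrow> x [^] k \<otimes> g \<otimes> y [^] k = t \<otimes> s \<otimes> t"
      using assms conj_eq_iff[of t "x [^] k \<otimes> g \<otimes> y [^] k" s] by simp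
    also have "\<dots> \<longleftrightarrow> g = y [^] k \<otimes> (t \<otimes> s \<otimes> t) \<otimes> x [^] k"
      using assms unfolding xy by (simp add: conj_eq_iff)
    also have "y [^] k \<otimes> (t \<otimes> s \<otimes> t) \<otimes> x [^] k = y [^] k \<otimes> y \<otimes> (t \<otimes> x [^] k)"
      by (simp add: y_def m_assoc)
    also have "\<dots> = y [^] k \<otimes> y \<otimes> y [^] k \<otimes> t"
      by (simp add: tx m_assoc)
    also have "y [^] k \<otimes> y \<otimes> y [^] k = y [^] Suc (2 * k)"
    proof -
      have "y [^] k \<otimes> y \<otimes> y [^] k = y [^] (Suc k + k)"
        unfolding nat_pow_mult[OF c(2), symmetric] by simp
      then show ?thesis by (simp add: mult_2)
    qed
    finally show ?thesis .
  qed
  have gk: "x [^] k \<otimes> g \<otimes> y [^] k \<in> carrier G" using assms by simp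
  have conj: "s \<otimes> (t \<otimes> (x [^] k \<otimes> g \<otimes> y [^] k) \<otimes> t) \<otimes> s = x [^] Suc k \<otimes> g \<otimes> y [^] Suc k"
  proof -
    have "x [^] Suc k = x \<otimes> x [^] k" by (metis c(1) nat_pow_Suc2)
    then show ?thesis using assms by (simp add: x_def y_def m_assoc)
  qed
  have "((flip s \<circ> flip t) ^^ Suc k) (g, e) = flip s (flip t (((flip s \<circ> flip t) ^^ k) (g, e)))"
    by simp
  also note Suc.IH
  also have "flip s (flip t ((s \<otimes> t) [^] k \<otimes> g \<otimes> (t \<otimes> s) [^] k,
     e \<noteq> odd (\<Sum>j<2 * k. of_bool (g = (t \<otimes> s) [^] j \<otimes> t) :: nat))) =
     (x [^] Suc k \<otimes> g \<otimes> y [^] Suc k,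
      ((e \<noteq> odd (\<Sum>j<2 * k. of_bool (g = y [^] j \<otimes> t) :: nat)) \<noteq> (g = y [^] (2 * k) \<otimes> t))
        \<noteq> (g = y [^] Suc (2 * k) \<otimes> t))"
    using gk by (simp only: flip.simps eq1 eq2 conj if_True m_closed c flip: x_def y_def)
  finally show ?case
    by (auto simp flip: x_def y_def)
qed

text \<open>The reflections \<open>(ts)\<^sup>j t\<close> are periodic in \<open>j\<close> with period \<open>n\<close>, so that each is met an even
  number of times.\<close>

lemma flip_relation:
  assumes "s \<in> S" "t \<in> S" "m s t = enat n"
  shows "((flip s \<circ> flip t) ^^ n) p = p"
proof (cases p)
  case (Pair g e)
  have pow: "(s \<otimes> t) [^] n = \<one>" "(t \<otimes> s) [^] n = \<one>"
    using relation assms m_sym by metis+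
  show ?thesis
  proof (cases "g \<in> carrier G")
    case True
    let ?h = "\<lambda>j. of_bool (g = (t \<otimes> s) [^] j \<otimes> t) :: nat"
    have "(\<Sum>j<n + k. ?h j) = (\<Sum>j<n. ?h j) + (\<Sum>j<k. ?h j)" for k
    proof (induction k)
      case (Suc k)
      have "(t \<otimes> s) [^] (n + k) = (t \<otimes> s) [^] k"
        using assms pow by (simp flip: nat_pow_mult)
      with Suc show ?case by simp
    qed simp
    from this[of n] have "even (\<Sum>j<2 * n. ?h j)" by (simp add: mult_2)
    with True assms pow Pair show ?thesis by (simp add: flip_pow)
  next
    case False
    then have "((flip s \<circ> flip t) ^^ k) (g, e) = (g, e)" for k by (induction k) auto
    with Pair show ?thesis by simp
  qed
qed

lemma fst_foldr_flip:
  "set ss \<subseteq> S \<Longrightarrow> g \<in> carrier G \<Longrightarrow> fst (foldr flip ss (g, e)) = ev ss \<otimes> g \<otimes> inv (ev ss)"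
proof (induction ss)
  case (Cons s ss)
  obtain g' e' where p: "foldr flip ss (g, e) = (g', e')" by force
  with Cons have "g' = ev ss \<otimes> g \<otimes> inv (ev ss)" by simp
  with p Cons.prems show ?case by (simp add: m_assoc inv_mult_group)
qed simp

text \<open>A net sign change forces some letter \<open>s\<close> to meet its own reflection: if
  \<open>x\<close> is the product of the letters after it, then \<open>x g x^-1 = s\<close>. Hence
  \<open>s x g = x\<close>, which deletes that letter.\<close>

lemma deletion_if_flipped:
  assumes "set ss \<subseteq> S" "g \<in> carrier G" "snd (foldr flip ss (g, e)) \<noteq> e"
  shows "\<exists>us r vs. ss = us @ r # vs \<and> ev ss \<otimes> g = ev (us @ vs)"
  using assms
proof (induction ss)
  case (Cons s ss)
  let ?x = "ev ss"
  have ss: "s \<in> S" "set ss \<subseteq> S" "?x \<in> carrier G" using Cons.prems by auto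
  show ?case
  proof (cases "snd (foldr flip ss (g, e)) = e")
    case False
    with Cons ss obtain us r vs where "ss = us @ r # vs" "?x \<otimes> g = ev (us @ vs)" by blast
    with ss Cons.prems show ?thesis
      by (intro exI[of _ "s # us"] exI[of _ r] exI[of _ vs]) (simp add: m_assoc)
  next
    case True
    then have "foldr flip ss (g, e) = (?x \<otimes> g \<otimes> inv ?x, e)"
      using fst_foldr_flip[of ss g e] ss Cons.prems by (simp add: prod_eq_iff)
    with Cons.prems ss have "?x \<otimes> g \<otimes> inv ?x = s" by (auto split: if_splits)
    then have "?x \<otimes> g = s \<otimes> ?x"
      using ss Cons.prems by (metis inv_solve_right m_closed S_closed)
    then have "ev (s # ss) \<otimes> g = ev ss"
      using ss Cons.prems by (simp add: m_assoc)
    then show ?thesis by (intro exI[of _ "[]"] exI[of _ s] exI[of _ ss]) simp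
  qed
qed simp

text \<open>The word \<open>ss\<close> need not be reduced. It is compared with a reduced word
  \<open>rs\<close> of the product: as \<open>s\<close> flips its own sign, exactly one of
  \<open>ss\<close> and \<open>rs\<close> changes the sign of the reflection
  \<open>s\<close>.\<close>

lemma exchange_right:
  assumes ss: "set ss \<subseteq> S" and s: "s \<in> S" and le: "len (ev ss \<otimes> s) \<le> len (ev ss)"
  shows "\<exists>us r vs. ss = us @ r # vs \<and> ev ss \<otimes> s = ev (us @ vs)"
proof -
  obtain rs where rs: "set rs \<subseteq> S" "ev rs = ev ss \<otimes> s" "length rs = len (ev ss \<otimes> s)"
    using reduced_word ss s by (metis S_closed ev_closed m_closed)
  have "foldr flip ss (s, False) = foldr flip (rs @ [s]) (s, False)"
    using ss s rs by (intro foldr_action_eq[OF flip_flip flip_relation]) auto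
  also have "\<dots> = foldr flip rs (s, True)"
    using s by simp
  finally have eq: "foldr flip ss (s, False) = foldr flip rs (s, True)" .
  \<comment> \<open>Otherwise a deletion in \<open>rs\<close> would write \<open>ev ss\<close> with
    fewer than \<open>len (ev ss \<otimes> s)\<close> letters, against \<open>le\<close>.\<close>
  have "snd (foldr flip rs (s, True))"
  proof (rule ccontr)
    assume "\<not> snd (foldr flip rs (s, True))"
    then obtain us r vs where d: "rs = us @ r # vs" "ev rs \<otimes> s = ev (us @ vs)"
      using deletion_if_flipped[of rs s True] rs s by auto
    then have "ev ss = ev (us @ vs)" using rs ss s by simp
    moreover have "len (ev (us @ vs)) \<le> length (us @ vs)"
      using d rs by (intro len_ev_le) auto
    ultimately show False using le rs(3) d(1) by simp
  qed
  with eq deletion_if_flipped[of ss s False] ss s show ?thesis by auto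
qed

text \<open>This is the right-hand version for the reversed word, which represents the
  inverse.\<close>

lemma exchange_left:
  assumes ss: "set ss \<subseteq> S" and s: "s \<in> S" and le: "len (s \<otimes> ev ss) \<le> len (ev ss)"
  shows "\<exists>us r vs. ss = us @ r # vs \<and> s \<otimes> ev ss = ev (us @ vs)"
proof -
  have eq: "ev (rev ss) \<otimes> s = inv (s \<otimes> ev ss)"
    using ss s by (simp add: ev_rev inv_mult_group)
  have "len (ev (rev ss) \<otimes> s) \<le> len (ev (rev ss))"
    using ss s le by (simp add: eq) (simp add: ev_rev)
  then obtain us r vs where d: "rev ss = us @ r # vs" "ev (rev ss) \<otimes> s = ev (us @ vs)"
    using exchange_right[of "rev ss" s] ss s unfolding set_rev by blast
  have sub: "set (us @ vs) \<subseteq> S" using arg_cong[OF d(1), of set] ss by auto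
  have ss_eq: "ss = rev vs @ r # rev us" using arg_cong[OF d(1), of rev] by simp
  have "s \<otimes> ev ss = inv (ev (us @ vs))"
    using d(2) eq ss s by (metis S_closed ev_closed inv_inv m_closed)
  also have "\<dots> = ev (rev vs @ rev us)" using ev_rev[OF sub] by simp
  finally show ?thesis using ss_eq by blast
qed

lemma reduced_Cons:
  assumes "set (s # ss) \<subseteq> S" "length (s # ss) = len (ev (s # ss))"
  shows "length ss = len (ev ss)" "len (s \<otimes> ev (s # ss)) < len (ev (s # ss))"
proof -
  show 1: "length ss = len (ev ss)"
    using len_ev_le[of ss] len_mult_le[of s "ev ss"] len_S_le[of s] assms by auto
  show "len (s \<otimes> ev (s # ss)) < len (ev (s # ss))"
    using 1 assms by simp
qed

text \<open>Otherwise exchange would delete a letter from the empty word.\<close>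

lemma S_neq_one: "s \<in> S \<Longrightarrow> s \<noteq> \<one>"
proof
  assume s: "s \<in> S" "s = \<one>"
  then obtain us r vs where "[] = us @ r # vs"
    using exchange_left[of "[]" s] by auto
  then show False by simp
qed

subsection \<open>Standard parabolic subgroups\<close>

text \<open>A letter of \<open>J\<close> appended to a reduced word over \<open>J\<close> either
  lengthens the element or, by exchange, amounts to deleting a letter; the result is again reduced
  and over \<open>J\<close>.\<close>

lemma parabolic_reduced_word:
  assumes "x \<in> generate G J" "J \<subseteq> S"
  obtains ks where "set ks \<subseteq> J" "ev ks = x" "length ks = len x"
proof -
  have "\<exists>ks. set ks \<subseteq> J \<and> ev ks = ev js \<and> length ks = len (ev js)" if "set js \<subseteq> J" for js
    using that
  proof (induction js rule: rev_induct)
    case (snoc j js)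
    then obtain ks where ks: "set ks \<subseteq> J" "ev ks = ev js" "length ks = len (ev js)" by auto
    have j: "j \<in> S" "j \<in> J" and sub: "set ks \<subseteq> S" "set js \<subseteq> S" using snoc.prems ks assms(2) by auto
    have ev: "ev (js @ [j]) = ev ks \<otimes> j" using sub j ks by simp
    show ?case
    proof (cases "len (ev ks \<otimes> j) \<le> len (ev ks)")
      case True
      then obtain us r vs where d: "ks = us @ r # vs" "ev ks \<otimes> j = ev (us @ vs)"
        using exchange_right[OF sub(1) j(1)] by blast
      have uv: "set (us @ vs) \<subseteq> J" using d(1) ks(1) by auto
      \<comment> \<open>Multiplying by \<open>j\<close> shortens by at most one, so the word left
        after the deletion is reduced.\<close>
      have "len (ev ks) \<le> len (ev ks \<otimes> j) + 1"
        using len_mult_le[of "ev ks \<otimes> j" j] sub j len_S_le[of j] by simp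
      then have "length (us @ vs) \<le> len (ev (us @ vs))"
        using d ks by simp
      moreover have "len (ev (us @ vs)) \<le> length (us @ vs)"
        using uv assms(2) by (intro len_ev_le) auto
      ultimately have "length (us @ vs) = len (ev (us @ vs))" by simp
      with uv d(2) ev show ?thesis by metis
    next
      case False
      with ks sub j len_ev_le[of "ks @ [j]"] ev show ?thesis
        by (intro exI[of _ "ks @ [j]"]) auto
    qed
  qed simp
  with assms that show ?thesis by (metis generate_word)
qed

lemma generate_Int_S:
  assumes "s \<in> generate G J" "s \<in> S" "J \<subseteq> S"
  shows "s \<in> J"
proof -
  obtain ks where ks: "set ks \<subseteq> J" "ev ks = s" "length ks = len s"
    using parabolic_reduced_word assms by metis
  then have "length ks \<le> 1" "ks \<noteq> []"
    using len_S_le assms S_neq_one[of s] by auto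
  then obtain j where "ks = [j]" by (cases ks) auto
  with ks assms show ?thesis by auto
qed

text \<open>If \<open>s\<close> did not lengthen \<open>x\<close>, exchange in a word over
  \<open>J\<close> would put \<open>s \<otimes> x\<close>, and hence \<open>s\<close>, into the
  subgroup.\<close>

lemma ascent_left:
  assumes "x \<in> generate G J" "J \<subseteq> S" "s \<in> S" "s \<notin> J"
  shows "len x < len (s \<otimes> x)"
proof (rule ccontr)
  assume le: "\<not> ?thesis"
  obtain ks where ks: "set ks \<subseteq> J" "ev ks = x" using assms generate_word by metis
  then have "set ks \<subseteq> S" using assms by auto
  with le ks assms obtain us r vs where d: "ks = us @ r # vs" "s \<otimes> x = ev (us @ vs)"
    using exchange_left[of ks s] by (metis not_less)
  have "set (us @ vs) \<subseteq> J" using d(1) ks(1) by auto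
  then have "s \<otimes> x \<in> generate G J" unfolding d(2) by (rule ev_in_generate)
  then have "s \<otimes> x \<otimes> inv x \<in> generate G J" using assms generate_inv generate_mult by blast
  moreover have "s \<otimes> x \<otimes> inv x = s" using assms generate_closed by (simp add: m_assoc)
  ultimately show False using generate_Int_S assms by metis
qed

lemma ascent_right:
  assumes "x \<in> generate G J" "J \<subseteq> S" "s \<in> S" "s \<notin> J"
  shows "len x < len (x \<otimes> s)"
proof -
  have x: "x \<in> carrier G" using assms generate_closed by blast
  have "len (x \<otimes> s) = len (s \<otimes> inv x)"
    using len_inv[of "x \<otimes> s"] x assms by (simp add: inv_mult_group)
  with ascent_left[of "inv x" J s] generate_inv assms x show ?thesis by simp
qed

text \<open>The first letter of a reduced word shortens the element, so it lies in \<open>J\<close>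
  by \<open>ascent_left\<close>; the tail is treated likewise.\<close>

lemma reduced_in_parabolic:
  assumes "set ss \<subseteq> S" "length ss = len (ev ss)" "ev ss \<in> generate G J" "J \<subseteq> S"
  shows "set ss \<subseteq> J"
  using assms(1-3)
proof (induction ss)
  case (Cons s ss)
  have s: "s \<in> J"
  proof (rule ccontr)
    assume "s \<notin> J"
    with ascent_left[OF Cons.prems(3) assms(4)] Cons.prems(1)
    have "len (ev (s # ss)) < len (s \<otimes> ev (s # ss))"
      by (metis insert_subset list.simps(15))
    with reduced_Cons(2)[OF Cons.prems(1,2)] show False by linarith
  qed
  then have "s \<otimes> ev (s # ss) \<in> generate G J"
    using Cons.prems(3) assms(4) generate.incl generate_mult by metis
  with Cons.prems have "ev ss \<in> generate G J" by simp
  with Cons reduced_Cons(1)[OF Cons.prems(1,2)] s show ?case by simp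
qed simp

text \<open>For the first letter \<open>q\<close>, two uses of the exchange condition give
  \<open>s q s = q\<close>; then \<open>q\<close> can be stripped off, and the hypotheses pass to
  the tail.\<close>

lemma conjugate_in_parabolic_commute:
  assumes I: "I \<subseteq> S" and s: "s \<in> S" "s \<notin> I"
    and ks: "set ks \<subseteq> I" "length ks = len (ev ks)"
    and conj: "s \<otimes> ev ks \<otimes> s \<in> generate G I"
    and r: "r \<in> set ks"
  shows "s \<otimes> r = r \<otimes> s"
  using ks conj r
proof (induction ks)
  case (Cons q ks)
  let ?k = "ev (q # ks)"
  have q: "q \<in> S" "q \<in> I" "q \<noteq> s" and sub: "set (q # ks) \<subseteq> S" "set ks \<subseteq> S"
    using Cons.prems I s by auto
  have cl: "?k \<in> carrier G" "s \<in> carrier G" "q \<in> carrier G" using ev_closed[OF sub(1)] s q by auto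
  have kI: "?k \<in> generate G I" using Cons.prems by (intro ev_in_generate)
  obtain ls where ls: "set ls \<subseteq> I" "ev ls = s \<otimes> ?k \<otimes> s"
    using generate_word[OF Cons.prems(3) I] by metis
  have lsS: "set ls \<subseteq> S" "ev ls \<in> carrier G" using ls(1) I by (auto simp del: ev_append)
  have sl: "ev (s # ls) = ?k \<otimes> s" using ls cl s by (simp add: m_assoc del: ev_Cons) (simp add: m_assoc)
  \<comment> \<open>On the left \<open>q\<close> shortens \<open>?k\<close>, while on the right
    \<open>s\<close> lengthens it; so \<open>q\<close> shortens \<open>?k \<otimes> s\<close>, which
    is also the value of \<open>s # ls\<close>.\<close>
  have "len (q \<otimes> (?k \<otimes> s)) \<le> len (q \<otimes> ?k) + 1"
    using len_mult_le[of "q \<otimes> ?k" s] len_S_le[OF s(1)] cl by (simp add: m_assoc)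
  also have "\<dots> < len (?k \<otimes> s)"
    using reduced_Cons(2)[OF sub(1) Cons.prems(2)] ascent_right[OF kI I s] by linarith
  finally have "len (q \<otimes> ev (s # ls)) \<le> len (ev (s # ls))" by (simp only: sl)
  then obtain us p vs where d: "s # ls = us @ p # vs" "q \<otimes> ev (s # ls) = ev (us @ vs)"
    using exchange_left[of "s # ls" q] q s lsS by (metis insert_subset list.simps(15))
  have qs: "q \<otimes> s \<noteq> \<one>"
    using q s cl by (metis S_cancel_right l_one)
  \<comment> \<open>Deleting the leading \<open>s\<close> would give
    \<open>q \<otimes> s = \<one>\<close>. So the deleted letter is in \<open>ls\<close>, which
    exhibits \<open>s q s\<close> as a quotient of words over \<open>I\<close>.\<close>
  have "s \<otimes> q \<otimes> s \<in> generate G I"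
  proof (cases us)
    case Nil
    with d have "q \<otimes> s \<otimes> ev ls = ev ls" using cl lsS by (simp add: m_assoc)
    with qs cl lsS show ?thesis by (simp add: r_cancel_one)
  next
    case (Cons u us')
    with d(1) have us: "u = s" "ls = us' @ p # vs" by auto
    have uv: "set (us' @ vs) \<subseteq> I" using us(2) ls(1) by auto
    have uvI: "ev (us' @ vs) \<in> generate G I" using uv by (rule ev_in_generate)
    have uvS: "ev (us' @ vs) \<in> carrier G" using I uvI by (rule generate_closed)
    have "q \<otimes> (s \<otimes> ev ls) = s \<otimes> ev (us' @ vs)" using d(2) Cons us by simp
    then have "s \<otimes> q \<otimes> s \<otimes> ev ls = ev (us' @ vs)"
      using cl lsS s uvS by (simp add: m_assoc del: ev_append)
    then have "s \<otimes> q \<otimes> s = ev (us' @ vs) \<otimes> inv (ev ls)"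
      using cl lsS(2) uvS inv_solve_right[of "s \<otimes> q \<otimes> s" "ev (us' @ vs)" "ev ls"] by simp
    then show ?thesis
      using uvI ls I by (metis ev_in_generate generate_inv generate_mult)
  qed
  \<comment> \<open>As \<open>s\<close> is not in \<open>I\<close>, it lengthens
    \<open>s q s\<close> to \<open>q s\<close>. So \<open>s\<close> shortens \<open>q s\<close>, and
    exchange in this two-letter word leaves \<open>s\<close> or \<open>q\<close>.\<close>
  from ascent_left[OF this I s] have "len (s \<otimes> ev [q, s]) \<le> len (ev [q, s])"
    using cl s by (simp add: m_assoc)
  then obtain us p vs where e: "[q, s] = us @ p # vs" "s \<otimes> ev [q, s] = ev (us @ vs)"
    using exchange_left[of "[q, s]" s] q s by (metis empty_set empty_subsetI insert_subset list.simps(15))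
  have "s \<otimes> q \<otimes> s = s \<or> s \<otimes> q \<otimes> s = q"
    using e cl by (cases us) (auto simp: m_assoc Cons_eq_append_conv)
  moreover have "s \<otimes> q \<otimes> s \<noteq> s"
    using qs cl by (simp add: m_assoc l_cancel_one)
  ultimately have sqs: "s \<otimes> q \<otimes> s = q" by blast
  then have sq: "s \<otimes> q = q \<otimes> s" using s cl by (metis S_cancel_right m_closed)
  have "s \<otimes> ev ks \<otimes> s = q \<otimes> (s \<otimes> ?k \<otimes> s)"
  proof -
    have "q \<otimes> (s \<otimes> ?k \<otimes> s) = (q \<otimes> s) \<otimes> q \<otimes> ev ks \<otimes> s"
      using cl sub by (simp add: m_assoc)
    also have "\<dots> = s \<otimes> ev ks \<otimes> s"
      using cl sub q by (simp flip: sq)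
    finally show ?thesis by simp
  qed
  then have "s \<otimes> ev ks \<otimes> s \<in> generate G I"
    using Cons.prems(3) q I by (metis generate.incl generate_mult)
  then show ?case
    using Cons reduced_Cons(1)[OF sub(1) Cons.prems(2)] sq by auto
qed simp

subsection \<open>The numbers game\<close>

text \<open>Twice the symmetric bilinear form of the geometric representation. For
  \<open>m s s = 1\<close> the cosine gives 2, and -2 is the limit as \<open>m s t\<close>
  grows.\<close>

definition cartan :: "'a \<Rightarrow> 'a \<Rightarrow> real" where
  "cartan s t = (case m s t of enat n \<Rightarrow> - 2 * cos (pi / n) | \<infinity> \<Rightarrow> - 2)"

text \<open>The action of the generators in the contragredient of the geometric representation.\<close>

definition fire :: "'a \<Rightarrow> ('a \<Rightarrow> real) \<Rightarrow> 'a \<Rightarrow> real" where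
  "fire s f = (\<lambda>t. f t - cartan s t * f s)"

lemma cartan_self: "s \<in> S \<Longrightarrow> cartan s s = 2"
  using m_eq_1_iff[of s s] by (simp add: cartan_def one_enat_def)

lemma cartan_sym: "s \<in> S \<Longrightarrow> t \<in> S \<Longrightarrow> cartan s t = cartan t s"
  by (simp add: cartan_def m_sym)

lemma fire_fire: "s \<in> S \<Longrightarrow> fire s (fire s f) = f"
  by (auto simp: fire_def cartan_self)

text \<open>The values fired alternately at \<open>t\<close> and \<open>s\<close> are
  \<open>v 0\<close>, \<open>v 1\<close> and so on. They obey
  \<open>v (x + 1) = 2 * cos (pi / n) * v x - v (x - 1)\<close> with \<open>v 0 = f t\<close> and
  \<open>v (-1) = - f s\<close>, a recurrence solved by sines.\<close>

lemma fire_pow: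
  fixes f :: "'a \<Rightarrow> real"
  assumes st: "s \<in> S" "t \<in> S" and mst: "m s t = enat n"
    and nz: "sin (pi / n) \<noteq> 0"
  defines "v \<equiv> \<lambda>x. (f t * sin ((x + 1) * (pi / n)) + f s * sin (x * (pi / n))) / sin (pi / n)"
  shows "((fire s \<circ> fire t) ^^ k) f =
    (\<lambda>r. f r - cartan t r * (\<Sum>i<k. v (2 * real i)) - cartan s r * (\<Sum>i<k. v (2 * real i + 1)))
    \<and> ((fire s \<circ> fire t) ^^ k) f t = v (2 * real k)
    \<and> ((fire s \<circ> fire t) ^^ k) f s = - v (2 * real k - 1)"
proof (induction k)
  case 0
  with nz show ?case by (simp add: v_def sin_minus)
next
  case (Suc k)
  let ?h = "((fire s \<circ> fire t) ^^ k) f"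
  have rec: "v (x + 1) = 2 * cos (pi / n) * v x - v (x - 1)" for x
  proof -
    have two: "sin ((y + 1 + 1) * z) = 2 * cos z * sin ((y + 1) * z) - sin (y * z)" for y z :: real
    proof -
      have "(y + 1 + 1) * z = (y + 1) * z + z" "y * z = (y + 1) * z - z"
        by (simp_all add: algebra_simps)
      then show ?thesis by (simp only: sin_add sin_diff) simp
    qed
    have "sin ((x + 1 + 1) * (pi / n)) = 2 * cos (pi / n) * sin ((x + 1) * (pi / n)) - sin (x * (pi / n))"
      "sin ((x + 1) * (pi / n)) = 2 * cos (pi / n) * sin (x * (pi / n)) - sin ((x - 1) * (pi / n))"
      using two[of x "pi / n"] two[of "x - 1" "pi / n"] by simp_all
    then have "f t * sin ((x + 1 + 1) * (pi / n)) + f s * sin ((x + 1) * (pi / n)) =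
      2 * cos (pi / n) * (f t * sin ((x + 1) * (pi / n)) + f s * sin (x * (pi / n)))
      - (f t * sin ((x - 1 + 1) * (pi / n)) + f s * sin ((x - 1) * (pi / n)))"
      by (simp only:) (simp add: algebra_simps)
    then show ?thesis unfolding v_def by (simp only: diff_divide_distrib times_divide_eq_right)
  qed
  have cst: "cartan s t = - 2 * cos (pi / n)" "cartan t s = - 2 * cos (pi / n)"
    using st mst m_sym[of s t] by (auto simp: cartan_def)
  have h: "?h r = f r - cartan t r * (\<Sum>i<k. v (2 * real i))
      - cartan s r * (\<Sum>i<k. v (2 * real i + 1))" for r
    using Suc.IH[THEN conjunct1] by (rule fun_cong)
  have ht: "?h t = v (2 * real k)" and hs: "?h s = - v (2 * real k - 1)"
    using Suc.IH by blast+
  have fs: "fire t ?h s = v (2 * real k + 1)"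
    by (simp add: fire_def ht hs cst rec[of "2 * real k"])
  have step: "((fire s \<circ> fire t) ^^ Suc k) f =
    (\<lambda>r. ?h r - cartan t r * v (2 * real k) - cartan s r * v (2 * real k + 1))"
    using fs by (simp add: fire_def ht)
  have "v (2 * real (Suc k)) = 2 * cos (pi / n) * v (2 * real k + 1) - v (2 * real k)"
    using rec[of "2 * real k + 1"] by (simp add: algebra_simps)
  moreover have "v (2 * real (Suc k) - 1) = 2 * cos (pi / n) * v (2 * real k) - v (2 * real k - 1)"
    using rec[of "2 * real k"] by (simp add: algebra_simps)
  moreover have "v (2 * real k + 1) = v (2 * real (Suc k) - 1)"
    by (simp add: algebra_simps)
  ultimately show ?case
    unfolding step by (auto simp: ht hs cst cartan_self st) (simp add: h algebra_simps)
qed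

text \<open>Over \<open>n\<close> rounds the values fired at each generator sum to zero, being
  combinations of sines at steps of \<open>2 * pi / n\<close>.\<close>

lemma fire_relation:
  assumes "s \<in> S" "t \<in> S" "m s t = enat n"
  shows "((fire s \<circ> fire t) ^^ n) f = f"
proof (cases "s = t")
  case True
  \<comment> \<open>The divisor \<open>sin (pi / n)\<close> vanishes here, but \<open>fire s\<close>
    is an involution.\<close>
  then have "n = 1" using assms m_eq_1_iff[of s s] by (simp add: one_enat_def)
  with True assms show ?thesis by (simp add: fire_fire)
next
  case False
  then have n: "n \<ge> 2"
    using assms m_eq_1_iff[of s t] m_ge_1[of s t] by (simp add: one_enat_def)
  then have "0 < pi / n" "pi / n < pi" by (simp_all add: field_simps)
  then have nz: "sin (pi / n) \<noteq> 0" using sin_gt_zero by fastforce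
  have "(\<Sum>i<n. (f t * sin ((2 * real i + c + 1) * (pi / n)) + f s * sin ((2 * real i + c) * (pi / n)))
      / sin (pi / n)) = 0" for c
    using sum_sin_roots[OF n, of "(c + 1) * (pi / n)"] sum_sin_roots[OF n, of "c * (pi / n)"]
    by (simp add: sum.distrib flip: sum_divide_distrib sum_distrib_left) (simp add: algebra_simps add_divide_distrib)
  from this[of 0] this[of 1] show ?thesis
    using fire_pow[OF assms nz, of n f] by simp
qed

text \<open>The relations only bound the order of \<open>s \<otimes> t\<close> from above; the
  action by \<open>fire\<close> separates the two products.\<close>

lemma commute_imp_m_less_3:
  assumes "s \<in> S" "t \<in> S" "s \<otimes> t = t \<otimes> s"
  shows "\<not> 3 \<le> m s t"
proof
  assume ge: "3 \<le> m s t"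
  then have "s \<noteq> t" using assms m_eq_1_iff[of s t] by auto
  \<comment> \<open>The indicator of \<open>s\<close> is fixed by \<open>fire t\<close>. At
    \<open>s\<close> the two products give -1 and \<open>-1 + (cartan s t)^2\<close>, and the Cartan
    entry of an edge is negative.\<close>
  define f :: "'a \<Rightarrow> real" where "f = (\<lambda>r. of_bool (r = s))"
  have "foldr fire [s, t] f = foldr fire [t, s] f"
    using assms by (intro foldr_action_eq[OF fire_fire fire_relation]) auto
  then have "fire s (fire t f) s = fire t (fire s f) s" by simp
  with \<open>s \<noteq> t\<close> have "cartan s t = 0"
    using assms by (simp add: fire_def f_def cartan_self cartan_sym[of t s])
  moreover have "cartan s t < 0"
  proof (cases "m s t")
    case (enat n)
    with ge have "n \<ge> 3" by (simp add: numeral_eq_enat)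
    then have "0 < pi / n" "pi / n < pi / 2" by (simp_all add: field_simps)
    then have "cos (pi / n) > 0" by (intro cos_gt_zero)
    with enat show ?thesis by (simp add: cartan_def)
  qed (simp add: cartan_def)
  ultimately show False by simp
qed

subsection \<open>An element that is maximal modulo a parabolic subgroup\<close>

text \<open>By induction on \<open>gs\<close>, a letter prepended to \<open>gs\<close> is absorbed
  either by deleting a letter of \<open>hs\<close>, with \<open>as\<close> kept, or by prepending it
  to \<open>as\<close>.\<close>

lemma prefix_of_translate:
  assumes A: "A \<subseteq> S"
    and ws: "set ws \<subseteq> S" "length ws = len (ev ws)"
    and conj: "\<And>a. a \<in> A \<Longrightarrow> inv (ev ws) \<otimes> a \<otimes> ev ws \<in> S"
    and desc: "\<And>s. s \<in> S \<Longrightarrow> s \<notin> A \<Longrightarrow> len (s \<otimes> ev ws) \<le> len (ev ws)"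
    and gs: "set gs \<subseteq> S" "length gs = len (ev gs)"
  shows "\<exists>as hs. set as \<subseteq> A \<and> set hs \<subseteq> S \<and> ev as \<otimes> ev ws = ev gs \<otimes> ev hs \<and>
    length as + length ws = len (ev as \<otimes> ev ws) \<and>
    length as + length ws = length gs + length hs"
  using gs
proof (induction gs)
  case Nil
  show ?case
    by (rule exI[of _ "[]"], rule exI[of _ ws]) (use ws in auto)
next
  case (Cons s gs)
  define w where "w = ev ws"
  have s: "s \<in> S" and gsS: "set gs \<subseteq> S" using Cons.prems by auto
  obtain as hs where as: "set as \<subseteq> A" and hs: "set hs \<subseteq> S" and eq: "ev as \<otimes> w = ev gs \<otimes> ev hs"
    and red: "length as + length ws = len (ev as \<otimes> w)"
    and lens: "length as + length ws = length gs + length hs"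
    using Cons.IH[OF gsS reduced_Cons(1)[OF Cons.prems]] unfolding w_def by blast
  have asS: "set as \<subseteq> S" using as A by auto
  have cl [simp]: "ev as \<in> carrier G" "w \<in> carrier G" "ev gs \<in> carrier G" "ev hs \<in> carrier G"
    using asS ws gsS hs by (auto simp: w_def)
  show ?case
  proof (cases "len (s \<otimes> (ev as \<otimes> w)) \<le> len (ev as \<otimes> w)")
    case True
    have gh: "ev (gs @ hs) = ev as \<otimes> w" using gsS hs eq by simp
    have "len (s \<otimes> ev (gs @ hs)) \<le> len (ev (gs @ hs))" using True by (simp only: gh)
    then obtain us r vs where d: "gs @ hs = us @ r # vs" "s \<otimes> ev (gs @ hs) = ev (us @ vs)"
      using exchange_left[of "gs @ hs" s] s gsS hs by (metis le_sup_iff set_append)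
    from d(1) consider (left) vs' where "gs = us @ r # vs'" "vs = vs' @ hs"
      | (right) us' where "us = gs @ us'" "hs = us' @ r # vs"
      by (auto simp: append_eq_append_conv2 Cons_eq_append_conv append_eq_Cons_conv)
    then show ?thesis
    proof cases
      \<comment> \<open>A letter deleted inside \<open>gs\<close> would contradict that
        \<open>s # gs\<close> is reduced.\<close>
      case left
      have uv: "set us \<subseteq> S" "set vs' \<subseteq> S" "r \<in> S" using left(1) gsS by auto
      have "s \<otimes> ev gs \<otimes> ev hs = ev (us @ vs') \<otimes> ev hs"
        using d(2) left(2) uv hs gsS s by (simp add: m_assoc)
      then have "s \<otimes> ev gs = ev (us @ vs')"
        using uv hs s by simp
      then have "len (ev (s # gs)) \<le> length (us @ vs')"
        using len_ev_le[of "us @ vs'"] uv by simp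
      with Cons.prems(2) left(1) show ?thesis by simp
    next
      case right
      have uv: "set us' \<subseteq> S" "set vs \<subseteq> S" using right(2) hs by auto
      have "s \<otimes> (ev gs \<otimes> ev hs) = ev gs \<otimes> ev (us' @ vs)"
        using d(2) right(1) uv hs gsS s by (simp add: m_assoc)
      then have "ev gs \<otimes> ev hs = s \<otimes> (ev gs \<otimes> ev (us' @ vs))"
        using s by (metis S_cancel cl(3,4) m_closed)
      then have "ev as \<otimes> w = ev (s # gs) \<otimes> ev (us' @ vs)"
        using eq s uv by (simp add: m_assoc)
      then show ?thesis
        using as uv red lens right(2) unfolding w_def
        by (intro exI[of _ as] exI[of _ "us' @ vs"]) (auto simp del: ev_append ev_Cons)
    qed
  next
    case False
    have inv_cancel: "w \<otimes> (inv w \<otimes> y) = y" if "y \<in> carrier G" for y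
      using that by (simp flip: m_assoc)
    have "s \<in> A"
    proof (rule ccontr)
      assume "s \<notin> A"
      then have "len (s \<otimes> w) \<le> len w" using desc s by (simp add: w_def)
      then obtain us r vs where d: "ws = us @ r # vs" "s \<otimes> w = ev (us @ vs)"
        using exchange_left[OF ws(1) s] by (auto simp: w_def)
      then have less: "len (s \<otimes> w) < length ws"
        using len_ev_le[of "us @ vs"] ws(1) by simp
      \<comment> \<open>Conjugation by \<open>w\<close> turns each letter of \<open>as\<close> into
        a generator, so \<open>ev as\<close> crosses \<open>w\<close> without needing more letters.
        A generator that shortens \<open>w\<close> then also shortens the whole product.\<close>
      have bs: "\<exists>bs. set bs \<subseteq> S \<and> length bs = length as \<and> ev as \<otimes> w = w \<otimes> ev bs"
        using as
      proof (induction as)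
        case Nil
        show ?case by (rule exI[of _ "[]"]) simp
      next
        case (Cons a as)
        then obtain bs where bs: "set bs \<subseteq> S" "length bs = length as" "ev as \<otimes> w = w \<otimes> ev bs" by auto
        have a: "a \<in> S" "inv w \<otimes> a \<otimes> w \<in> S" "ev as \<in> carrier G"
          using Cons.prems A conj by (auto simp: w_def)
        have "ev (a # as) \<otimes> w = a \<otimes> (w \<otimes> ev bs)" using a bs(3) by (simp add: m_assoc)
        also have "\<dots> = w \<otimes> ev ((inv w \<otimes> a \<otimes> w) # bs)"
          using a(1) bs(1) inv_cancel by (simp add: m_assoc)
        finally show ?case using a(2) bs by (intro exI[of _ "(inv w \<otimes> a \<otimes> w) # bs"]) simp
      qed
      then obtain bs where bs: "set bs \<subseteq> S" "length bs = length as" "ev as \<otimes> w = w \<otimes> ev bs" by blast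
      have "len (s \<otimes> (ev as \<otimes> w)) = len (s \<otimes> w \<otimes> ev bs)"
        using bs s by (simp add: m_assoc)
      also have "\<dots> \<le> len (s \<otimes> w) + length bs"
        using len_mult_le[of "s \<otimes> w" "ev bs"] len_ev_le[of bs] bs s by simp
      finally show False using less bs(2) red False by simp
    qed
    have "len (s \<otimes> (ev as \<otimes> w)) \<le> 1 + len (ev as \<otimes> w)"
      using len_mult_le[of s "ev as \<otimes> w"] len_S_le[of s] s by simp
    with False have "len (s \<otimes> (ev as \<otimes> w)) = 1 + len (ev as \<otimes> w)" by simp
    then show ?thesis
      using \<open>s \<in> A\<close> as hs red lens eq s unfolding w_def[symmetric]
      by (intro exI[of _ "s # as"] exI[of _ hs]) (simp add: m_assoc)
  qed
qed

text \<open>The word \<open>hs\<close> is stripped from the right: its last letter shortens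
  \<open>ev xs\<close>, and exchange realises this by deleting a letter of \<open>xs\<close>, which
  need not be reduced.\<close>

lemma prefix_is_subword:
  assumes "g \<in> carrier G" "set hs \<subseteq> S" "set xs \<subseteq> S"
    and "ev xs = g \<otimes> ev hs" "len (ev xs) = len g + length hs"
  shows "\<exists>ys. subseq ys xs \<and> ev ys = g"
  using assms(2-5)
proof (induction hs arbitrary: xs rule: rev_induct)
  case Nil
  with assms(1) show ?case by auto
next
  case (snoc r hs)
  have r: "r \<in> S" "set hs \<subseteq> S" using snoc.prems by auto
  have eq: "ev xs \<otimes> r = g \<otimes> ev hs" using snoc.prems r assms(1) by (simp add: m_assoc)
  have le: "len (g \<otimes> ev hs) \<le> len g + length hs"
    using len_mult_le[of g "ev hs"] len_ev_le[of hs] r assms(1) by simp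
  then obtain us p vs where d: "xs = us @ p # vs" "ev xs \<otimes> r = ev (us @ vs)"
    using exchange_right[of xs r] snoc.prems r eq by auto
  \<comment> \<open>With \<open>le\<close>, this pins the new length exactly, as the induction
    hypothesis requires.\<close>
  have "len (ev xs) \<le> len (ev xs \<otimes> r) + 1"
    using len_mult_le[of "ev xs \<otimes> r" r] len_S_le[of r] snoc.prems(2) r by simp
  then have "len (ev (us @ vs)) = len g + length hs"
    using le snoc.prems(4) eq d(2) by simp
  moreover have "set (us @ vs) \<subseteq> S" using d(1) snoc.prems(2) by auto
  ultimately obtain ys where "subseq ys (us @ vs)" "ev ys = g"
    using snoc.IH[of "us @ vs"] r d(2) eq by auto
  moreover have "subseq (us @ vs) xs" using d(1) by (simp add: subseq_append' list_emb_Cons)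
  ultimately show ?case by (metis subseq_order.trans)
qed

text \<open>A subword of \<open>as @ ws\<close> splits into a subword of \<open>as\<close>, whose
  value lies in the parabolic subgroup, and one of \<open>ws\<close>. The latter are finitely many,
  independently of \<open>g\<close>.\<close>

lemma finite_index_parabolic:
  assumes "A \<subseteq> S" "set ws \<subseteq> S" "length ws = len (ev ws)"
    and "\<And>a. a \<in> A \<Longrightarrow> inv (ev ws) \<otimes> a \<otimes> ev ws \<in> S"
    and "\<And>s. s \<in> S \<Longrightarrow> s \<notin> A \<Longrightarrow> len (s \<otimes> ev ws) \<le> len (ev ws)"
    and "g \<in> carrier G"
  shows "\<exists>a \<in> generate G A. \<exists>f \<in> ev ` {ys. subseq ys ws}. g = a \<otimes> f"
proof -
  obtain gs where gs: "set gs \<subseteq> S" "ev gs = g" "length gs = len g"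
    using assms(6) by (rule reduced_word)
  obtain as hs where as: "set as \<subseteq> A" and hs: "set hs \<subseteq> S"
    and eq: "ev as \<otimes> ev ws = g \<otimes> ev hs" "length as + length ws = len (ev as \<otimes> ev ws)"
      "length as + length ws = length gs + length hs"
    using prefix_of_translate[OF assms(1-5) gs(1)] gs by auto
  have asS: "set as \<subseteq> S" using as assms(1) by auto
  then obtain ys where "subseq ys (as @ ws)" "ev ys = g"
    using prefix_is_subword[of g hs "as @ ws"] assms(2,6) hs eq gs(3) by auto
  then obtain us vs where uv: "ys = us @ vs" "subseq us as" "subseq vs ws"
    by (metis subseq_appendE)
  have "set us \<subseteq> A" "set vs \<subseteq> S"
    using list_emb_set[OF uv(2)] list_emb_set[OF uv(3)] as assms(2) by blast+
  with uv assms(1) \<open>ev ys = g\<close> have "ev us \<in> generate G A" "g = ev us \<otimes> ev vs"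
    by (auto simp: ev_in_generate)
  with uv show ?thesis by blast
qed

section \<open>Conjugates confined to a parabolic subgroup, and the conclusion\<close>

lemma core_absorbs_component:
  assumes A: "A \<subseteq> S" and k: "k \<in> carrier G"
    and core: "\<And>g. g \<in> carrier G \<Longrightarrow> g \<otimes> k \<otimes> inv g \<in> generate G A"
    and ks: "set ks \<subseteq> S" "ev ks = k" "length ks = len k"
    and r: "r \<in> set ks" and path: "(r, d) \<in> (coxeter_edges S m)\<^sup>*"
  shows "d \<in> A"
proof -
  define K where "K = {g \<otimes> k \<otimes> inv g | g. g \<in> carrier G}"
  \<comment> \<open>The joint support of all conjugates of \<open>k\<close>. All reduced words are
    included, so any choice made by \<open>reduced_word\<close> is covered.\<close>
  define I where "I = \<Union> {set ks | ks. set ks \<subseteq> S \<and> length ks = len (ev ks) \<and> ev ks \<in> K}"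
  have KA: "K \<subseteq> generate G A" using core by (auto simp: K_def)
  have IA: "I \<subseteq> A"
  proof
    fix i assume "i \<in> I"
    then obtain ls where ls: "set ls \<subseteq> S" "length ls = len (ev ls)" "ev ls \<in> K" "i \<in> set ls"
      unfolding I_def by blast
    then show "i \<in> A" using reduced_in_parabolic[OF ls(1,2) _ A] KA by blast
  qed
  have KI: "x \<in> generate G I" if x: "x \<in> K" for x
  proof -
    have "x \<in> carrier G" using x KA generate_closed[OF A] by blast
    then obtain ls where "set ls \<subseteq> S" "ev ls = x" "length ls = len x" by (rule reduced_word)
    with x have "set ls \<subseteq> I" "ev ls = x" unfolding I_def by blast+
    then show ?thesis using ev_in_generate by blast
  qed
  have conj: "s \<otimes> x \<otimes> s \<in> K" if "x \<in> K" "s \<in> S" for x s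
  proof -
    obtain g where g: "g \<in> carrier G" "x = g \<otimes> k \<otimes> inv g" using \<open>x \<in> K\<close> unfolding K_def by blast
    have "s \<otimes> x \<otimes> s = (s \<otimes> g) \<otimes> k \<otimes> inv (s \<otimes> g)"
      using g that(2) k by (simp add: inv_mult_group m_assoc)
    moreover have "s \<otimes> g \<in> carrier G" using g(1) that(2) by simp
    ultimately show ?thesis unfolding K_def by (intro CollectI exI conjI)
  qed
  have "k \<in> K" unfolding K_def using k by (intro CollectI exI[of _ \<one>]) simp
  with ks r have "r \<in> I" unfolding I_def by blast
  with path have "d \<in> I"
  proof (induction rule: rtrancl_induct)
    case (step q s)
    then have "q \<in> I" and s: "s \<in> S" "q \<in> S" "3 \<le> m q s" by (auto simp: coxeter_edges_def)
    show ?case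
    proof (rule ccontr)
      assume "s \<notin> I"
      \<comment> \<open>The value of \<open>ls\<close> and its conjugate by \<open>s\<close> both
        lie in the subgroup of \<open>I\<close>, so \<open>s\<close> and \<open>q\<close> would
        commute although an edge joins them.\<close>
      obtain ls where ls: "set ls \<subseteq> S" "length ls = len (ev ls)" "ev ls \<in> K" "q \<in> set ls"
        using \<open>q \<in> I\<close> unfolding I_def by blast
      then have "set ls \<subseteq> I" unfolding I_def by blast
      moreover have "I \<subseteq> S" using IA A by blast
      ultimately have "s \<otimes> q = q \<otimes> s"
        using conjugate_in_parabolic_commute[of I s ls q] ls s \<open>s \<notin> I\<close> KI conj by blast
      with commute_imp_m_less_3[of q s] s show False by simp
    qed
  qed
  with IA show ?thesis by blast
qed

end

theorem lemma2p2:
  fixes W :: "('a, 'b) monoid_scheme"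
    and S :: "'a set"
    and m :: "'a \<Rightarrow> 'a \<Rightarrow> enat"
    and w :: 'a
  assumes "coxeter_system W S m"
    and "purely_infinite W S m"
    and "w \<in> carrier W"
    and "w \<noteq> \<one>\<^bsub>W\<^esub>"
  shows "\<exists>s \<in> S. inv\<^bsub>W\<^esub> w \<otimes>\<^bsub>W\<^esub> s \<otimes>\<^bsub>W\<^esub> w \<notin> S \<and>
           coxeter_length W S (s \<otimes>\<^bsub>W\<^esub> w) > coxeter_length W S w"
proof (rule ccontr)
  assume neg: "\<not> ?thesis"
  interpret group W
    using assms(1) by (simp add: coxeter_system_def has_presentation_def)
  interpret coxeter W S m
    by unfold_locales (rule assms(1))
  define A where "A = {s \<in> S. len w < len (s \<otimes>\<^bsub>W\<^esub> w)}"
  have A: "A \<subseteq> S" by (auto simp: A_def)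
  obtain ws where ws: "set ws \<subseteq> S" "ev ws = w" "length ws = len w"
    using assms(3) by (rule reduced_word)
  \<comment> \<open>The first letter of a reduced word of \<open>w\<close> shortens
    \<open>w\<close>, so it lies outside \<open>A\<close>.\<close>
  obtain d ws' where d: "ws = d # ws'"
    using ws(2) assms(4) by (cases ws) auto
  have dS: "d \<in> S" using ws d by simp
  have "d \<notin> A"
    using reduced_Cons(2)[of d ws'] ws d by (auto simp: A_def)
  let ?E = "coxeter_edges S m"
  define C where "C = {t \<in> S. (d, t) \<in> ?E\<^sup>*}"
  have CS: "C \<subseteq> S" by (auto simp: C_def)
  have C_eq: "C = {(s, t). s \<in> S \<and> t \<in> S \<and> (s, t) \<in> ?E\<^sup>*} `` {d}"
    using dS by (auto simp: C_def)
  have "C \<in> coxeter_components S m"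
    unfolding coxeter_components_def C_eq using dS by (rule quotientI)
  then have inf: "infinite (generate W C)"
    using assms(2) by (simp add: purely_infinite_def)
  let ?F = "ev ` {ys. subseq ys ws}"
  have F: "finite ?F" by (simp flip: set_subseqs_eq)
  have FW: "?F \<subseteq> carrier W"
  proof
    fix x assume "x \<in> ?F"
    then obtain ys where ys: "subseq ys ws" "x = ev ys" by blast
    then have "set ys \<subseteq> S" using list_emb_set[OF ys(1)] ws(1) by blast
    with ys show "x \<in> carrier W" by simp
  qed
  have cover: "\<exists>a \<in> generate W A. \<exists>f \<in> ?F. g = a \<otimes>\<^bsub>W\<^esub> f" if "g \<in> carrier W" for g
    using neg ws by (intro finite_index_parabolic[OF A ws(1) _ _ _ that]) (auto simp: A_def)
  have CW: "generate W C \<subseteq> carrier W" using generate_closed[OF CS] by blast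
  \<comment> \<open>The infinite set is the subgroup of the component of \<open>d\<close>; thus the
    quotient of \<open>x\<close> and \<open>y\<close> lies in it, while all conjugates of this
    quotient lie in the subgroup of \<open>A\<close>.\<close>
  obtain x y where xy: "x \<in> generate W C" "y \<in> generate W C" "x \<noteq> y"
    "\<And>g. g \<in> carrier W \<Longrightarrow> g \<otimes>\<^bsub>W\<^esub> (x \<otimes>\<^bsub>W\<^esub> inv\<^bsub>W\<^esub> y) \<otimes>\<^bsub>W\<^esub> inv\<^bsub>W\<^esub> g \<in> generate W A"
    using finite_index_core[OF generate_subgroup[OF A] F FW cover inf CW] by blast
  define k where "k = x \<otimes>\<^bsub>W\<^esub> inv\<^bsub>W\<^esub> y"
  have xyW: "x \<in> carrier W" "y \<in> carrier W" using xy generate_closed[OF CS] by auto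
  have kC: "k \<in> generate W C"
    using xy CS by (simp add: k_def generate_mult generate_inv)
  have k: "k \<in> carrier W" using kC generate_closed[OF CS] by blast
  have "k \<noteq> \<one>\<^bsub>W\<^esub>"
    using xy(3) xyW by (metis inv_equality inv_inv inv_closed k_def)
  \<comment> \<open>The reduced word is taken over \<open>C\<close>, so that each of its letters is
    joined to \<open>d\<close> by a path.\<close>
  obtain ks where ks: "set ks \<subseteq> C" "ev ks = k" "length ks = len k"
    using parabolic_reduced_word[OF kC CS] by metis
  with \<open>k \<noteq> \<one>\<^bsub>W\<^esub>\<close> obtain r where r: "r \<in> set ks" by (cases ks) auto
  with ks(1) have "(d, r) \<in> ?E\<^sup>*" by (auto simp: C_def)
  moreover have "sym ?E" using m_sym by (auto simp: sym_def coxeter_edges_def)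
  ultimately have "(r, d) \<in> ?E\<^sup>*" by (meson sym_rtrancl symD)
  then have "d \<in> A"
    using core_absorbs_component[OF A k _ _ ks(2,3) r] xy(4) ks(1) CS by (simp add: k_def)
  with \<open>d \<notin> A\<close> show False by contradiction
qed

end
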